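(* Let $\lambda>0$. For every $\boldsymbol f\in\mathbb C^{|\mathcal X|}$ the ordinary cross-validation score $$P(\lambda)=\sum_{x\in\mathcal X}\left|\left[\boldsymbol F\tilde{\boldsymbol f}_{(x)}\right]_x-f_x\right|^2$$ can be written as $$P(\lambda)=\sum_{x\in\mathcal X}\frac{\left|[\boldsymbol H\boldsymbol f-\boldsymbol f]_x\right|^2}{(1-h_{x,x})^2},$$ where $h_{x,x}$, $x\in\mathcal X$, are the diagonal entries of the hat matrix $\boldsymbol H=\boldsymbol F(\boldsymbol F^{\mathsf H}\boldsymbol W\boldsymbol F+\lambda\hat{\boldsymbol W})^{-1}\boldsymbol F^{\mathsf H}\boldsymbol W$.
   Context: Let $\mathcal I$ be a finite index set, $X\subset\mathbb R^d$, $\varphi_{n}\colon X\to\mathbb C$ ($n\in\mathcal I$) functions, and $\mathcal X\subset X$ a finite set of nodes. Put $\boldsymbol F=(\varphi_n(x))_{x\in\mathcal X,n\in\mathcal I}\in\mathbb C^{|\mathcal X|\times|\mathcal I|}$; rows are indexed by nodes and columns by $\mathcal I$. Let $\boldsymbol W=\operatorname{diag}(w_x)_{x\in\mathcal X}$ and $\hat{\boldsymbol W}=\operatorname{diag}(\hat w_n)_{n\in\mathcal I}$ be real diagonal matrices with strictly positive diagonal entries. $^{\mathsf H}$ denotes conjugate transpose. For $x\in\mathcal X$ and a data vector $\boldsymbol f=(f_y)_{y\in\mathcal X}$: $\boldsymbol f_{(x)}=(f_y)_{y\in\mathcal X\setminus\{x\}}$; $\boldsymbol F_{(x)}$ is $\boldsymbol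 F$ with the row belonging to $x$ removed; $\boldsymbol W_{(x)}$ is $\boldsymbol W$ with the row and column belonging to $x$ removed. The leave-one-out Tikhonov minimizer is $$\tilde{\boldsymbol f}_{(x)}=\left(\boldsymbol F_{(x)}^{\mathsf H}\boldsymbol W_{(x)}\boldsymbol F_{(x)}+\lambda\hat{\boldsymbol W}\right)^{-1}\boldsymbol F_{(x)}^{\mathsf H}\boldsymbol W_{(x)}\boldsymbol f_{(x)}\in\mathbb C^{|\mathcal I|}.$$ $[\boldsymbol v]_x$ denotes the entry of $\boldsymbol v\in\mathbb C^{|\mathcal X|}$ corresponding to $x$. *)

theory Defs
  imports
    "HOL-Analysis.Finite_Cartesian_Product"
    "Jordan_Normal_Form.Gauss_Jordan_Elimination"
    "Jordan_Normal_Form.Schur_Decomposition"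
    "Jordan_Normal_Form.DL_Submatrix"
begin

unbundle no vec_syntax

hide_type (open) Finite_Cartesian_Product.vec
hide_const (open) Finite_Cartesian_Product.vec Finite_Cartesian_Product.mat

(* The nodes and the index set are listed without repetition as xs and ns; row k of the
   system matrix belongs to the node xs ! k, column j to the index ns ! j. *)

definition system_mat :: "('i \<Rightarrow> 'x \<Rightarrow> complex) \<Rightarrow> 'x list \<Rightarrow> 'i list \<Rightarrow> complex mat" where
  "system_mat \<phi> xs ns = mat (length xs) (length ns) (\<lambda>(k, j). \<phi> (ns ! j) (xs ! k))"

definition weight_mat :: "('x \<Rightarrow> real) \<Rightarrow> 'x list \<Rightarrow> complex mat" where
  "weight_mat w xs = mat_diag (length xs) (\<lambda>k. complex_of_real (w (xs ! k)))"

definition remove_row :: "nat \<Rightarrow> 'a mat \<Rightarrow> 'a mat" where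
  "remove_row k A = submatrix A (- {k}) UNIV"

definition remove_entry :: "nat \<Rightarrow> 'a vec \<Rightarrow> 'a vec" where
  "remove_entry k v = vec_of_list (nths (list_of_vec v) (- {k}))"

definition tikhonov_mat ::
  "complex mat \<Rightarrow> complex mat \<Rightarrow> complex mat \<Rightarrow> real \<Rightarrow> complex mat" where
  "tikhonov_mat F W Wh l = mat_adjoint F * W * F + complex_of_real l \<cdot>\<^sub>m Wh"

(* Unspecified if A is not invertible, since mat_inverse A is then None. *)
definition inv_mat :: "complex mat \<Rightarrow> complex mat" where
  "inv_mat A = the (mat_inverse A)"

definition tikhonov_minimizer ::
  "complex mat \<Rightarrow> complex mat \<Rightarrow> complex mat \<Rightarrow> real \<Rightarrow> complex vec \<Rightarrow> complex vec" where
  "tikhonov_minimizer F W Wh l f =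
     (inv_mat (tikhonov_mat F W Wh l) * mat_adjoint F * W) *\<^sub>v f"

definition loo_minimizer ::
  "complex mat \<Rightarrow> complex mat \<Rightarrow> complex mat \<Rightarrow> real \<Rightarrow> complex vec \<Rightarrow> nat \<Rightarrow> complex vec" where
  "loo_minimizer F W Wh l f k =
     tikhonov_minimizer (remove_row k F) (mat_delete W k k) Wh l (remove_entry k f)"

definition hat_mat ::
  "complex mat \<Rightarrow> complex mat \<Rightarrow> complex mat \<Rightarrow> real \<Rightarrow> complex mat" where
  "hat_mat F W Wh l = F * inv_mat (tikhonov_mat F W Wh l) * mat_adjoint F * W"

definition ocv_score ::
  "complex mat \<Rightarrow> complex mat \<Rightarrow> complex mat \<Rightarrow> complex vec \<Rightarrow> real \<Rightarrow> real" where
  "ocv_score F W Wh f l =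
     (\<Sum>k<dim_row F. (cmod ((F *\<^sub>v loo_minimizer F W Wh l f k) $ k - f $ k))\<^sup>2)"

end

theory Submission
  imports Defs
begin

text \<open>
  The proof uses the classical leave-one-out argument. Let \<open>p\<close> be the prediction at the node \<open>k\<close> of
  the minimizer computed without this node. Reinserting \<open>k\<close> with the artificial datum \<open>p\<close> adds a
  term to the Tikhonov functional that vanishes at this minimizer, so it also solves the full problem
  with the datum \<open>f\<^sub>k\<close> replaced by \<open>p\<close>
  (\<open>loo_minimizer_eq_minimizer_of_own_prediction\<close>). The full problem depends linearly on its data
  through the hat matrix, hence \<open>p = (H f)\<^sub>k + (p - f\<^sub>k) h\<^sub>k\<^sub>k\<close>, that is,
  \<open>(p - f\<^sub>k) (1 - h\<^sub>k\<^sub>k) = (H f - f)\<^sub>k\<close> (\<open>loo_residual\<close>).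

  Three facts turn this into the formula for the score. The Tikhonov matrices of the full and the
  reduced problems are invertible, because their quadratic forms are positive definite
  (\<open>tikhonov_energy\<close>, \<open>tikhonov_inverse\<close>). The entry \<open>h\<^sub>k\<^sub>k\<close> is real, so that the squared modulus of
  \<open>1 - h\<^sub>k\<^sub>k\<close> is its square (\<open>hat_mat_diag_real\<close>). It differs from 1, so that one may divide
  (\<open>hat_mat_diag_neq_1\<close>). The last two facts come from reading \<open>h\<^sub>k\<^sub>k\<close> as the fitted value at \<open>k\<close> for
  the data vector that is 1 at \<open>k\<close> and 0 at all other nodes.

  All arguments work with the normal equations written coordinatewise as sums over the nodes. In this
  form the deletion of a node is the deletion of one summand.
\<close>

section \<open>Normal equations of the Tikhonov functional\<close>

abbreviation rdiag :: "nat \<Rightarrow> (nat \<Rightarrow> real) \<Rightarrow> complex mat" where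
  "rdiag n a \<equiv> mat_diag n (\<lambda>k. complex_of_real (a k))"

lemma rdiag_mult_vec:
  assumes "v \<in> carrier_vec n"
  shows "rdiag n a *\<^sub>v v = vec n (\<lambda>k. a k * v $ k)"
proof (rule eq_vecI)
  fix i assume "i < dim_vec (vec n (\<lambda>k. complex_of_real (a k) * v $ k))"
  then have i: "i < n" by simp
  have "(rdiag n a *\<^sub>v v) $ i = (\<Sum>j\<in>{0..<n}. (if i = j then complex_of_real (a j) else 0) * v $ j)"
    using i assms by (simp add: mat_diag_def scalar_prod_def)
  also have "\<dots> = (\<Sum>j\<in>{0..<n}. if i = j then a j * v $ j else 0)"
    by (rule sum.cong) auto
  also have "\<dots> = a i * v $ i" using i by simp
  finally show "(rdiag n a *\<^sub>v v) $ i = vec n (\<lambda>k. a k * v $ k) $ i" using i by simp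
qed (simp add: mat_diag_def)

lemma adjoint_carrier [simp]:
  assumes "F \<in> carrier_mat n m"
  shows "mat_adjoint F \<in> carrier_mat m n"
  using assms unfolding mat_adjoint_def by auto

lemma adjoint_index:
  assumes "F \<in> carrier_mat n m" "j < m" "r < n"
  shows "mat_adjoint F $$ (j, r) = cnj (F $$ (r, j))"
  using assms unfolding mat_adjoint_def by (auto simp: mat_of_rows_index)

lemma tikhonov_carrier [simp]:
  assumes "F \<in> carrier_mat n m"
  shows "tikhonov_mat F (rdiag n a) (rdiag m b) l \<in> carrier_mat m m"
  using assms unfolding tikhonov_mat_def
  by (metis add_carrier_mat mat_diag_dim smult_carrier_mat)

lemma normal_rhs_index:
  assumes F: "F \<in> carrier_mat n m" and g: "g \<in> carrier_vec n" and j: "j < m"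
  shows "((mat_adjoint F * rdiag n a) *\<^sub>v g) $ j = (\<Sum>r<n. cnj (F $$ (r, j)) * (a r * g $ r))"
proof -
  have "(mat_adjoint F * rdiag n a) *\<^sub>v g = mat_adjoint F *\<^sub>v (rdiag n a *\<^sub>v g)"
    using adjoint_carrier[OF F] g by (intro assoc_mult_mat_vec) auto
  also have "\<dots> $ j = (\<Sum>r = 0..<n. mat_adjoint F $$ (j, r) * (a r * g $ r))"
    using adjoint_carrier[OF F] j by (simp add: rdiag_mult_vec[OF g] scalar_prod_def)
  finally show ?thesis
    using j by (simp add: adjoint_index[OF F] lessThan_atLeast0)
qed

lemma tikhonov_mult_vec_index:
  assumes F: "F \<in> carrier_mat n m" and v: "v \<in> carrier_vec m" and j: "j < m"
  shows "(tikhonov_mat F (rdiag n a) (rdiag m b) l *\<^sub>v v) $ j =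
    (\<Sum>r<n. cnj (F $$ (r, j)) * (a r * (F *\<^sub>v v) $ r)) + l * b j * v $ j"
proof -
  have C: "mat_adjoint F * rdiag n a \<in> carrier_mat m n"
    using adjoint_carrier[OF F] by (rule mult_carrier_mat) simp
  have "tikhonov_mat F (rdiag n a) (rdiag m b) l *\<^sub>v v =
      (mat_adjoint F * rdiag n a * F) *\<^sub>v v + (complex_of_real l \<cdot>\<^sub>m rdiag m b) *\<^sub>v v"
    unfolding tikhonov_mat_def using C F v
    by (intro add_mult_distrib_mat_vec[where nr=m and nc=m]) auto
  also have "(mat_adjoint F * rdiag n a * F) *\<^sub>v v = (mat_adjoint F * rdiag n a) *\<^sub>v (F *\<^sub>v v)"
    using C F v by (intro assoc_mult_mat_vec) auto
  also have "(complex_of_real l \<cdot>\<^sub>m rdiag m b) *\<^sub>v v = complex_of_real l \<cdot>\<^sub>v (rdiag m b *\<^sub>v v)"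
    using v by (intro eq_vecI) (auto simp: mat_diag_def)
  finally show ?thesis
    using j F v C by (simp add: rdiag_mult_vec normal_rhs_index[OF F] mult_mat_vec_carrier[OF F v])
qed

text \<open>Exchanging the sum over the components with the sum over the nodes moves \<open>F\<close> to the other side of
  the inner product. The identity serves twice: for positive weights it shows definiteness, and for
  arbitrary real ones that the quadratic form takes real values.\<close>

lemma tikhonov_energy:
  assumes F: "F \<in> carrier_mat n m" and v: "v \<in> carrier_vec m"
  shows "(\<Sum>j<m. cnj (v $ j) * (tikhonov_mat F (rdiag n a) (rdiag m b) l *\<^sub>v v) $ j) =
    complex_of_real ((\<Sum>r<n. a r * (cmod ((F *\<^sub>v v) $ r))\<^sup>2) + l * (\<Sum>j<m. b j * (cmod (v $ j))\<^sup>2))"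
    (is "?L = _")
proof -
  have "?L = (\<Sum>j<m. \<Sum>r<n. cnj (v $ j) * (cnj (F $$ (r, j)) * (a r * (F *\<^sub>v v) $ r)))
      + (\<Sum>j<m. l * (b j * (v $ j * cnj (v $ j))))"
    by (simp add: tikhonov_mult_vec_index[OF F v] sum.distrib algebra_simps sum_distrib_left)
  also have "(\<Sum>j<m. \<Sum>r<n. cnj (v $ j) * (cnj (F $$ (r, j)) * (a r * (F *\<^sub>v v) $ r))) =
      (\<Sum>r<n. \<Sum>j<m. cnj (v $ j) * (cnj (F $$ (r, j)) * (a r * (F *\<^sub>v v) $ r)))"
    by (rule sum.swap)
  also have "\<dots> = (\<Sum>r<n. a r * ((F *\<^sub>v v) $ r * cnj ((F *\<^sub>v v) $ r)))"
  proof (rule sum.cong)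
    fix r assume "r \<in> {..<n}"
    then have "cnj ((F *\<^sub>v v) $ r) = (\<Sum>j<m. cnj (v $ j) * cnj (F $$ (r, j)))"
      using F v by (auto simp: scalar_prod_def lessThan_atLeast0 mult.commute intro!: sum.cong)
    then show "(\<Sum>j<m. cnj (v $ j) * (cnj (F $$ (r, j)) * (a r * (F *\<^sub>v v) $ r))) =
        a r * ((F *\<^sub>v v) $ r * cnj ((F *\<^sub>v v) $ r))"
      by (simp add: sum_distrib_left algebra_simps)
  qed simp
  finally show ?thesis
    by (simp add: complex_norm_square[symmetric] sum_distrib_left)
qed

text \<open>A vector in the kernel has zero energy. Neither sum in the energy is negative, so the penalty
  vanishes, and its strictly positive weights leave only the zero vector.\<close>

lemma tikhonov_kernel_trivial:
  assumes F: "F \<in> carrier_mat n m" and v: "v \<in> carrier_vec m"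
    and a: "\<forall>r<n. a r > 0" and b: "\<forall>j<m. b j > 0" and l: "l > 0"
    and null: "tikhonov_mat F (rdiag n a) (rdiag m b) l *\<^sub>v v = 0\<^sub>v m"
  shows "v = 0\<^sub>v m"
proof -
  define P where "P = (\<Sum>j<m. b j * (cmod (v $ j))\<^sup>2)"
  define Q where "Q = (\<Sum>r<n. a r * (cmod ((F *\<^sub>v v) $ r))\<^sup>2)"
  have "complex_of_real (Q + l * P) = 0"
    unfolding P_def Q_def tikhonov_energy[OF F v, symmetric] null by simp
  then have "Q + l * P = 0" by (simp only: of_real_eq_0_iff)
  moreover have "Q \<ge> 0" "P \<ge> 0"
    unfolding P_def Q_def using a b by (auto intro!: sum_nonneg mult_nonneg_nonneg less_imp_le[of 0 "a _"] less_imp_le[of 0 "b _"])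
  ultimately have "P = 0" using l
    by (metis add_nonneg_eq_0_iff less_le mult_eq_0_iff mult_nonneg_nonneg)
  then have "\<forall>j\<in>{..<m}. b j * (cmod (v $ j))\<^sup>2 = 0"
    unfolding P_def using b
    by (subst (asm) sum_nonneg_eq_0_iff) (auto intro!: mult_nonneg_nonneg less_imp_le[of 0 "b _"])
  then show ?thesis using v b by (intro eq_vecI) force+
qed

lemma tikhonov_inverse:
  assumes F: "F \<in> carrier_mat n m"
    and a: "\<forall>r<n. a r > 0" and b: "\<forall>j<m. b j > 0" and l: "l > 0"
  defines "A \<equiv> tikhonov_mat F (rdiag n a) (rdiag m b) l"
  shows "inv_mat A \<in> carrier_mat m m" "A * inv_mat A = 1\<^sub>m m" "inv_mat A * A = 1\<^sub>m m"
    "invertible_mat A"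
proof -
  have A: "A \<in> carrier_mat m m" unfolding A_def using F by simp
  have "v = 0\<^sub>v m" if "v \<in> carrier_vec m" "A *\<^sub>v v = 0\<^sub>v m" for v
    using tikhonov_kernel_trivial[OF F that(1) a b l] that(2) unfolding A_def by blast
  then have "det A \<noteq> 0"
    unfolding det_0_iff_vec_prod_zero_field[OF A] by blast
  then have "A \<in> Units (ring_mat TYPE(complex) m ())" by (rule det_non_zero_imp_unit[OF A])
  then obtain B where "mat_inverse A = Some B" using mat_inverse(1)[OF A] by fastforce
  then show inv: "inv_mat A \<in> carrier_mat m m" "A * inv_mat A = 1\<^sub>m m" "inv_mat A * A = 1\<^sub>m m"
    using mat_inverse(2)[OF A, of B] unfolding inv_mat_def by auto
  then show "invertible_mat A"
    using A unfolding invertible_mat_def inverts_mat_def by auto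
qed

lemma tikhonov_minimizer_carrier:
  assumes "F \<in> carrier_mat n m" and "g \<in> carrier_vec n"
    and "\<forall>r<n. a r > 0" and "\<forall>j<m. b j > 0" and "l > 0"
  shows "tikhonov_minimizer F (rdiag n a) (rdiag m b) l g \<in> carrier_vec m"
  unfolding tikhonov_minimizer_def
  using tikhonov_inverse(1)[OF assms(1,3-5)] adjoint_carrier[OF assms(1)] assms(2)
  by (intro mult_mat_vec_carrier[of _ _ n] mult_carrier_mat[of _ _ n] mult_carrier_mat[of _ _ m]) auto

text \<open>One direction yields the equations that the leave-one-out minimizer satisfies in the reduced
  problem. The other one recognises the same vector as the minimizer of a full problem.\<close>

lemma tikhonov_minimizer_iff_normal_equations:
  assumes F: "F \<in> carrier_mat n m" and v: "v \<in> carrier_vec m" and g: "g \<in> carrier_vec n"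
    and a: "\<forall>r<n. a r > 0" and b: "\<forall>j<m. b j > 0" and l: "l > 0"
  shows "v = tikhonov_minimizer F (rdiag n a) (rdiag m b) l g \<longleftrightarrow>
    tikhonov_mat F (rdiag n a) (rdiag m b) l *\<^sub>v v = (mat_adjoint F * rdiag n a) *\<^sub>v g"
proof -
  define A where "A = tikhonov_mat F (rdiag n a) (rdiag m b) l"
  define c where "c = (mat_adjoint F * rdiag n a) *\<^sub>v g"
  note inv = tikhonov_inverse[OF F a b l, folded A_def]
  have A: "A \<in> carrier_mat m m" unfolding A_def using F by simp
  have C: "mat_adjoint F * rdiag n a \<in> carrier_mat m n"
    using adjoint_carrier[OF F] by (rule mult_carrier_mat) simp
  have c: "c \<in> carrier_vec m" unfolding c_def using C g by simp
  have "tikhonov_minimizer F (rdiag n a) (rdiag m b) l g =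
      (inv_mat A * (mat_adjoint F * rdiag n a)) *\<^sub>v g"
    unfolding tikhonov_minimizer_def A_def[symmetric]
    by (simp only: assoc_mult_mat[OF inv(1) adjoint_carrier[OF F] mat_diag_dim])
  also have "\<dots> = inv_mat A *\<^sub>v c"
    unfolding c_def by (rule assoc_mult_mat_vec[OF inv(1) C g])
  finally have min: "tikhonov_minimizer F (rdiag n a) (rdiag m b) l g = inv_mat A *\<^sub>v c" .
  have "v = inv_mat A *\<^sub>v c \<longleftrightarrow> A *\<^sub>v v = c"
    using assoc_mult_mat_vec[OF A inv(1) c] assoc_mult_mat_vec[OF inv(1) A v] inv(2,3) v c
    by auto
  then show ?thesis unfolding min A_def c_def .
qed

lemma hat_mat_carrier:
  assumes F: "F \<in> carrier_mat n m"
    and "\<forall>r<n. a r > 0" and "\<forall>j<m. b j > 0" and "l > 0"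
  shows "hat_mat F (rdiag n a) (rdiag m b) l \<in> carrier_mat n n"
  unfolding hat_mat_def
  using tikhonov_inverse(1)[OF assms] adjoint_carrier[OF F] F
  by (intro mult_carrier_mat[of _ _ n] mult_carrier_mat[of _ _ m]) auto

lemma hat_mat_mult_vec:
  assumes F: "F \<in> carrier_mat n m" and g: "g \<in> carrier_vec n"
    and a: "\<forall>r<n. a r > 0" and b: "\<forall>j<m. b j > 0" and l: "l > 0"
  shows "hat_mat F (rdiag n a) (rdiag m b) l *\<^sub>v g =
    F *\<^sub>v tikhonov_minimizer F (rdiag n a) (rdiag m b) l g"
proof -
  define B where "B = inv_mat (tikhonov_mat F (rdiag n a) (rdiag m b) l)"
  have B: "B \<in> carrier_mat m m" unfolding B_def by (rule tikhonov_inverse(1)[OF F a b l])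
  note Fa = adjoint_carrier[OF F]
  have BFW: "B * mat_adjoint F * rdiag n a \<in> carrier_mat m n"
    using B Fa by (intro mult_carrier_mat[of _ _ n] mult_carrier_mat[of _ _ m]) auto
  have "F * B * mat_adjoint F * rdiag n a = F * (B * mat_adjoint F * rdiag n a)"
    using assoc_mult_mat[OF F B Fa] assoc_mult_mat[OF F mult_carrier_mat[OF B Fa] mat_diag_dim]
    by simp
  then show ?thesis
    unfolding hat_mat_def tikhonov_minimizer_def B_def[symmetric]
    using assoc_mult_mat_vec[OF F BFW g] by simp
qed

section \<open>Deleting a node\<close>

text \<open>Submatrices and sublists enumerate the kept positions with \<open>pick\<close>, deletion of a matrix entry
  with \<open>insert_index\<close>. Bringing both to \<open>insert_index\<close> aligns the reduced matrix, weights and data.\<close>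

lemma pick_compl_singleton: "pick (- {k}) i = insert_index k i"
proof -
  have "{a \<in> - {k}. a < insert_index k i} = (if i < k then {..<i} else {..<Suc i} - {k})"
    unfolding insert_index_def by auto
  then have "card {a \<in> - {k}. a < insert_index k i} = i" by auto
  then show ?thesis
    using pick_card_in_set[of "insert_index k i" "- {k}"] by simp
qed

lemma card_delete_index: "k < n \<Longrightarrow> card {i. i < n \<and> i \<noteq> k} = n - 1"
proof -
  assume "k < n"
  moreover have "{i. i < n \<and> i \<noteq> k} = {..<n} - {k}" by auto
  ultimately show ?thesis by simp
qed

lemma remove_row_eq:
  assumes "F \<in> carrier_mat n m" "k < n"
  shows "remove_row k F = mat (n - 1) m (\<lambda>(i, j). F $$ (insert_index k i, j))"
  using assms card_delete_index[OF assms(2)]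
  by (auto simp: remove_row_def submatrix_def pick_compl_singleton pick_UNIV)

lemma remove_entry_eq:
  assumes "f \<in> carrier_vec n" "k < n"
  shows "remove_entry k f = vec (n - 1) (\<lambda>i. f $ insert_index k i)"
proof (rule eq_vecI)
  have c: "card {i. i < n \<and> i \<in> - {k}} = n - 1" using card_delete_index[OF assms(2)] by simp
  show dim: "dim_vec (remove_entry k f) = dim_vec (vec (n - 1) (\<lambda>i. f $ insert_index k i))"
    using assms c by (auto simp: remove_entry_def length_nths)
  fix i assume i: "i < dim_vec (vec (n - 1) (\<lambda>i. f $ insert_index k i))"
  then have "insert_index k i < n" using assms by (auto simp: insert_index_def)
  then show "remove_entry k f $ i = vec (n - 1) (\<lambda>i. f $ insert_index k i) $ i"
    using i assms c
    by (auto simp: remove_entry_def vec_of_list_index nth_nths pick_compl_singleton list_of_vec_index)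
qed

lemma mat_delete_rdiag:
  assumes "k < n"
  shows "mat_delete (rdiag n a) k k = rdiag (n - 1) (\<lambda>i. a (insert_index k i))"
  using assms by (intro eq_matI) (auto simp: mat_delete_def mat_diag_def insert_index_def)

lemma sum_insert_index:
  fixes h :: "nat \<Rightarrow> 'b :: ab_group_add"
  assumes "k < n"
  shows "(\<Sum>i<n - 1. h (insert_index k i)) = (\<Sum>r<n. h r) - h k"
proof -
  have "insert_index k ` {..<n - 1} = {..<n} - {k}"
    using insert_index_image[of k "n - 1"] assms by (simp add: lessThan_atLeast0)
  then have "(\<Sum>i<n - 1. h (insert_index k i)) = sum h ({..<n} - {k})"
    using sum.reindex[OF insert_index_inj_on[of k "{..<n - 1}"], of h] by (simp add: o_def)
  also have "\<dots> = (\<Sum>r<n. h r) - h k"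
    using assms by (simp add: sum_diff1)
  finally show ?thesis .
qed

text \<open>Deleting node \<open>k\<close> is a rank-one downdate: the node's summand leaves the normal equations, on
  the left-hand side with the predicted value at \<open>k\<close> and on the right-hand side with the datum.\<close>

lemma tikhonov_remove_row:
  assumes F: "F \<in> carrier_mat n m" and v: "v \<in> carrier_vec m" and k: "k < n" and j: "j < m"
  shows "(tikhonov_mat (remove_row k F) (mat_delete (rdiag n a) k k) (rdiag m b) l *\<^sub>v v) $ j =
    (tikhonov_mat F (rdiag n a) (rdiag m b) l *\<^sub>v v) $ j
      - cnj (F $$ (k, j)) * (a k * (F *\<^sub>v v) $ k)"
proof -
  let ?G = "remove_row k F" and ?h = "\<lambda>r. cnj (F $$ (r, j)) * (a r * (F *\<^sub>v v) $ r)"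
  have G: "?G \<in> carrier_mat (n - 1) m" using remove_row_eq[OF F k] by simp
  have ins: "insert_index k i < n" if "i < n - 1" for i using that by (auto simp: insert_index_def)
  have row: "(?G *\<^sub>v v) $ i = (F *\<^sub>v v) $ insert_index k i" if "i < n - 1" for i
    using that ins[OF that] F v by (simp add: remove_row_eq[OF F k] scalar_prod_def)
  have "(\<Sum>i<n - 1. cnj (?G $$ (i, j)) * (a (insert_index k i) * (?G *\<^sub>v v) $ i)) =
      (\<Sum>i<n - 1. ?h (insert_index k i))"
    using j by (intro sum.cong) (auto simp: row, simp add: remove_row_eq[OF F k])
  also have "\<dots> = (\<Sum>r<n. ?h r) - ?h k" by (rule sum_insert_index[OF k])
  finally show ?thesis
    unfolding mat_delete_rdiag[OF k] tikhonov_mult_vec_index[OF G v j]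
      tikhonov_mult_vec_index[OF F v j] by simp
qed

lemma normal_rhs_remove_row:
  assumes F: "F \<in> carrier_mat n m" and f: "f \<in> carrier_vec n" and k: "k < n" and j: "j < m"
  shows "((mat_adjoint (remove_row k F) * mat_delete (rdiag n a) k k) *\<^sub>v remove_entry k f) $ j =
    ((mat_adjoint F * rdiag n a) *\<^sub>v f) $ j - cnj (F $$ (k, j)) * (a k * f $ k)"
proof -
  let ?G = "remove_row k F" and ?h = "\<lambda>r. cnj (F $$ (r, j)) * (a r * f $ r)"
  have G: "?G \<in> carrier_mat (n - 1) m" using remove_row_eq[OF F k] by simp
  have g: "remove_entry k f \<in> carrier_vec (n - 1)" using remove_entry_eq[OF f k] by simp
  have "(\<Sum>i<n - 1. cnj (?G $$ (i, j)) * (a (insert_index k i) * remove_entry k f $ i)) =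
      (\<Sum>i<n - 1. ?h (insert_index k i))"
    using j by (intro sum.cong) (auto simp: remove_row_eq[OF F k] remove_entry_eq[OF f k])
  also have "\<dots> = (\<Sum>r<n. ?h r) - ?h k" by (rule sum_insert_index[OF k])
  finally show ?thesis
    unfolding mat_delete_rdiag[OF k] normal_rhs_index[OF G g j]
      normal_rhs_index[OF F f j] by simp
qed

lemma normal_rhs_unit_vec:
  assumes F: "F \<in> carrier_mat n m" and k: "k < n" and j: "j < m"
  shows "((mat_adjoint F * rdiag n a) *\<^sub>v unit_vec n k) $ j = cnj (F $$ (k, j)) * a k"
proof -
  have "((mat_adjoint F * rdiag n a) *\<^sub>v unit_vec n k) $ j =
      (\<Sum>r<n. if r = k then cnj (F $$ (k, j)) * a k else 0)"
    unfolding normal_rhs_index[OF F unit_vec_carrier j]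
    using k by (intro sum.cong) auto
  then show ?thesis using k by simp
qed

section \<open>The diagonal of the hat matrix\<close>

lemma mult_mat_vec_unit:
  fixes A :: "'a :: semiring_1 mat"
  assumes "A \<in> carrier_mat n m" "k < m"
  shows "A *\<^sub>v unit_vec m k = col A k"
  using assms by (intro eq_vecI) auto

lemma hat_mat_diag_eq_fit:
  assumes F: "F \<in> carrier_mat n m" and k: "k < n"
    and a: "\<forall>r<n. a r > 0" and b: "\<forall>j<m. b j > 0" and l: "l > 0"
  shows "hat_mat F (rdiag n a) (rdiag m b) l $$ (k, k) =
    (F *\<^sub>v tikhonov_minimizer F (rdiag n a) (rdiag m b) l (unit_vec n k)) $ k"
proof -
  have "hat_mat F (rdiag n a) (rdiag m b) l *\<^sub>v unit_vec n k =
      col (hat_mat F (rdiag n a) (rdiag m b) l) k"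
    using mult_mat_vec_unit[OF hat_mat_carrier[OF F a b l] k] by simp
  then show ?thesis
    using hat_mat_mult_vec[OF F unit_vec_carrier a b l, of k] hat_mat_carrier[OF F a b l] k
    by (metis carrier_matD index_col)
qed

lemma unit_data_minimizer:
  assumes F: "F \<in> carrier_mat n m" and k: "k < n"
    and a: "\<forall>r<n. a r > 0" and b: "\<forall>j<m. b j > 0" and l: "l > 0"
  defines "z \<equiv> tikhonov_minimizer F (rdiag n a) (rdiag m b) l (unit_vec n k)"
  shows "z \<in> carrier_vec m"
    and "\<And>j. j < m \<Longrightarrow>
      (tikhonov_mat F (rdiag n a) (rdiag m b) l *\<^sub>v z) $ j = cnj (F $$ (k, j)) * a k"
proof -
  show z: "z \<in> carrier_vec m"
    unfolding z_def by (rule tikhonov_minimizer_carrier[OF F unit_vec_carrier a b l])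
  have "tikhonov_mat F (rdiag n a) (rdiag m b) l *\<^sub>v z =
      (mat_adjoint F * rdiag n a) *\<^sub>v unit_vec n k"
    by (rule tikhonov_minimizer_iff_normal_equations[OF F z unit_vec_carrier a b l, THEN iffD1])
      (simp only: z_def)
  then show "(tikhonov_mat F (rdiag n a) (rdiag m b) l *\<^sub>v z) $ j = cnj (F $$ (k, j)) * a k"
    if "j < m" for j
    using normal_rhs_unit_vec[OF F k that] by simp
qed

text \<open>Evaluating the energy identity at the minimizer \<open>z\<close> for unit data at node \<open>k\<close> gives the weight
  of that node times the conjugate of \<open>(F z)\<^sub>k = h\<^sub>k\<^sub>k\<close>. As the energy is real
  and the weight is a nonzero real number, the diagonal entry is real.\<close>

lemma hat_mat_diag_real:
  assumes F: "F \<in> carrier_mat n m" and k: "k < n"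
    and a: "\<forall>r<n. a r > 0" and b: "\<forall>j<m. b j > 0" and l: "l > 0"
  shows "hat_mat F (rdiag n a) (rdiag m b) l $$ (k, k) \<in> \<real>"
proof -
  define z where "z = tikhonov_minimizer F (rdiag n a) (rdiag m b) l (unit_vec n k)"
  define A where "A = tikhonov_mat F (rdiag n a) (rdiag m b) l"
  note z = unit_data_minimizer(1)[OF assms, folded z_def]
  note Az = unit_data_minimizer(2)[OF assms, folded z_def A_def]
  have "(\<Sum>j<m. cnj (z $ j) * (A *\<^sub>v z) $ j) = a k * cnj ((F *\<^sub>v z) $ k)"
    using F z k
    by (simp add: Az scalar_prod_def lessThan_atLeast0 sum_distrib_left algebra_simps)
  moreover have "(\<Sum>j<m. cnj (z $ j) * (A *\<^sub>v z) $ j) \<in> \<real>"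
    unfolding A_def tikhonov_energy[OF F z] by (rule Reals_of_real)
  ultimately have "a k * cnj ((F *\<^sub>v z) $ k) \<in> \<real>" by simp
  then have "cnj ((F *\<^sub>v z) $ k) \<in> \<real>"
    using a k by (auto simp: complex_is_Real_iff)
  then show ?thesis
    unfolding hat_mat_diag_eq_fit[OF assms] z_def[symmetric] by (simp add: complex_is_Real_iff)
qed

lemma remove_row_kernel_trivial:
  assumes F: "F \<in> carrier_mat n m" and k: "k < n" and v: "v \<in> carrier_vec m"
    and a: "\<forall>r<n. a r > 0" and b: "\<forall>j<m. b j > 0" and l: "l > 0"
    and null: "tikhonov_mat (remove_row k F) (mat_delete (rdiag n a) k k) (rdiag m b) l *\<^sub>v v = 0\<^sub>v m"
  shows "v = 0\<^sub>v m"
proof -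
  have G: "remove_row k F \<in> carrier_mat (n - 1) m" using remove_row_eq[OF F k] by simp
  have "\<forall>i<n - 1. a (insert_index k i) > 0"
    using a by (auto simp: insert_index_def)
  then show ?thesis
    using null unfolding mat_delete_rdiag[OF k] by (rule tikhonov_kernel_trivial[OF G v _ b l])
qed

text \<open>If \<open>h\<^sub>k\<^sub>k\<close> were 1, the minimizer for unit data at node \<open>k\<close> would reproduce its datum exactly.
  The summand of that node then cancels from the normal equations, so the minimizer solves the
  homogeneous equations of the other nodes. It is therefore zero and cannot reproduce the value 1.\<close>

lemma hat_mat_diag_neq_1:
  assumes F: "F \<in> carrier_mat n m" and k: "k < n"
    and a: "\<forall>r<n. a r > 0" and b: "\<forall>j<m. b j > 0" and l: "l > 0"
  shows "hat_mat F (rdiag n a) (rdiag m b) l $$ (k, k) \<noteq> 1"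
proof
  define z where "z = tikhonov_minimizer F (rdiag n a) (rdiag m b) l (unit_vec n k)"
  assume "hat_mat F (rdiag n a) (rdiag m b) l $$ (k, k) = 1"
  then have fit: "(F *\<^sub>v z) $ k = 1" unfolding hat_mat_diag_eq_fit[OF assms] z_def .
  note z = unit_data_minimizer(1)[OF assms, folded z_def]
  note Az = unit_data_minimizer(2)[OF assms, folded z_def]
  let ?T = "tikhonov_mat (remove_row k F) (mat_delete (rdiag n a) k k) (rdiag m b) l"
  have G: "remove_row k F \<in> carrier_mat (n - 1) m" using remove_row_eq[OF F k] by simp
  have T: "?T \<in> carrier_mat m m" unfolding mat_delete_rdiag[OF k] by (rule tikhonov_carrier[OF G])
  have "?T *\<^sub>v z = 0\<^sub>v m"
  proof (rule eq_vecI)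
    fix j assume "j < dim_vec (0\<^sub>v m)"
    then have j: "j < m" by simp
    then show "(?T *\<^sub>v z) $ j = 0\<^sub>v m $ j"
      unfolding tikhonov_remove_row[OF F z k j] Az[OF j] fit by simp
  qed (use T in auto)
  then have "z = 0\<^sub>v m" by (rule remove_row_kernel_trivial[OF F k z a b l])
  then have "(F *\<^sub>v z) $ k = 0" using F k by simp
  then show False using fit by simp
qed

section \<open>Leave-one-out residuals\<close>

text \<open>A datum that already equals the prediction adds nothing to the residual. Putting the node \<open>k\<close>
  back with the leave-one-out prediction as its datum therefore leaves the minimizer unchanged. In
  terms of the normal equations, the summands removed from both sides by the deletion agree.\<close>

lemma loo_minimizer_eq_minimizer_of_own_prediction:
  assumes F: "F \<in> carrier_mat n m" and f: "f \<in> carrier_vec n" and k: "k < n"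
    and a: "\<forall>r<n. a r > 0" and b: "\<forall>j<m. b j > 0" and l: "l > 0"
  defines "x \<equiv> loo_minimizer F (rdiag n a) (rdiag m b) l f k"
  shows "x = tikhonov_minimizer F (rdiag n a) (rdiag m b) l
    (f + ((F *\<^sub>v x) $ k - f $ k) \<cdot>\<^sub>v unit_vec n k)"
proof -
  define d where "d = (F *\<^sub>v x) $ k - f $ k"
  have G: "remove_row k F \<in> carrier_mat (n - 1) m" using remove_row_eq[OF F k] by simp
  have g: "remove_entry k f \<in> carrier_vec (n - 1)" using remove_entry_eq[OF f k] by simp
  have a': "\<forall>i<n - 1. a (insert_index k i) > 0"
    using a by (auto simp: insert_index_def)
  have x: "x \<in> carrier_vec m"
    unfolding x_def loo_minimizer_def mat_delete_rdiag[OF k]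
    by (rule tikhonov_minimizer_carrier[OF G g a' b l])
  have reduced: "tikhonov_mat (remove_row k F) (mat_delete (rdiag n a) k k) (rdiag m b) l *\<^sub>v x =
      (mat_adjoint (remove_row k F) * mat_delete (rdiag n a) k k) *\<^sub>v remove_entry k f"
    using tikhonov_minimizer_iff_normal_equations[OF G x g a' b l]
    unfolding x_def loo_minimizer_def mat_delete_rdiag[OF k] by simp
  have C: "mat_adjoint F * rdiag n a \<in> carrier_mat m n"
    using adjoint_carrier[OF F] by (rule mult_carrier_mat) simp
  have e: "d \<cdot>\<^sub>v unit_vec n k \<in> carrier_vec n" by simp
  have "tikhonov_mat F (rdiag n a) (rdiag m b) l *\<^sub>v x =
      (mat_adjoint F * rdiag n a) *\<^sub>v (f + d \<cdot>\<^sub>v unit_vec n k)"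
  proof (rule eq_vecI)
    fix j assume "j < dim_vec ((mat_adjoint F * rdiag n a) *\<^sub>v (f + d \<cdot>\<^sub>v unit_vec n k))"
    then have j: "j < m" using adjoint_carrier[OF F] by simp
    have "((mat_adjoint F * rdiag n a) *\<^sub>v (f + d \<cdot>\<^sub>v unit_vec n k)) $ j =
        ((mat_adjoint F * rdiag n a) *\<^sub>v f) $ j + d * (cnj (F $$ (k, j)) * a k)"
      using carrier_matD(1)[OF adjoint_carrier[OF F]] j mult_add_distrib_mat_vec[OF C f e] mult_mat_vec[OF C unit_vec_carrier, of d k]
        normal_rhs_unit_vec[OF F k j, of a] by simp
    moreover have "(tikhonov_mat F (rdiag n a) (rdiag m b) l *\<^sub>v x) $ j
        - cnj (F $$ (k, j)) * (a k * (F *\<^sub>v x) $ k) =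
        ((mat_adjoint F * rdiag n a) *\<^sub>v f) $ j - cnj (F $$ (k, j)) * (a k * f $ k)"
      using arg_cong[OF reduced, of "\<lambda>v. v $ j"]
      unfolding tikhonov_remove_row[OF F x k j] normal_rhs_remove_row[OF F f k j] .
    ultimately show "(tikhonov_mat F (rdiag n a) (rdiag m b) l *\<^sub>v x) $ j =
        ((mat_adjoint F * rdiag n a) *\<^sub>v (f + d \<cdot>\<^sub>v unit_vec n k)) $ j"
      unfolding d_def by (simp add: algebra_simps) (metis add_left_cancel)
  qed (use C tikhonov_carrier[OF F, of a b l] in auto)
  then show "x = tikhonov_minimizer F (rdiag n a) (rdiag m b) l
      (f + ((F *\<^sub>v x) $ k - f $ k) \<cdot>\<^sub>v unit_vec n k)"
    unfolding d_def[symmetric]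
    using tikhonov_minimizer_iff_normal_equations[OF F x add_carrier_vec[OF f e] a b l] by simp
qed

text \<open>Write \<open>p\<close> for the leave-one-out prediction at node \<open>k\<close>. As \<open>p\<close> is also the prediction of the
  full problem for the data changed at \<open>k\<close> only, linearity of the hat matrix gives
  \<open>p = (H f)\<^sub>k + (p - f\<^sub>k) h\<^sub>k\<^sub>k\<close>. Division by \<open>1 - h\<^sub>k\<^sub>k\<close> is postponed to the theorem.\<close>

lemma loo_residual:
  assumes F: "F \<in> carrier_mat n m" and f: "f \<in> carrier_vec n" and k: "k < n"
    and a: "\<forall>r<n. a r > 0" and b: "\<forall>j<m. b j > 0" and l: "l > 0"
  defines "H \<equiv> hat_mat F (rdiag n a) (rdiag m b) l"
  shows "((F *\<^sub>v loo_minimizer F (rdiag n a) (rdiag m b) l f k) $ k - f $ k) * (1 - H $$ (k, k)) =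
    (H *\<^sub>v f - f) $ k"
proof -
  define p where "p = (F *\<^sub>v loo_minimizer F (rdiag n a) (rdiag m b) l f k) $ k"
  let ?e = "(p - f $ k) \<cdot>\<^sub>v unit_vec n k"
  have H: "H \<in> carrier_mat n n" unfolding H_def by (rule hat_mat_carrier[OF F a b l])
  have e: "?e \<in> carrier_vec n" by simp
  have "F *\<^sub>v loo_minimizer F (rdiag n a) (rdiag m b) l f k =
      F *\<^sub>v tikhonov_minimizer F (rdiag n a) (rdiag m b) l (f + ?e)"
    unfolding p_def
    by (rule arg_cong[OF loo_minimizer_eq_minimizer_of_own_prediction[OF F f k a b l]])
  also have "\<dots> = H *\<^sub>v (f + ?e)"
    unfolding H_def by (rule hat_mat_mult_vec[OF F add_carrier_vec[OF f e] a b l, symmetric])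
  also have "\<dots> = H *\<^sub>v f + (p - f $ k) \<cdot>\<^sub>v col H k"
    using mult_add_distrib_mat_vec[OF H f e] mult_mat_vec[OF H unit_vec_carrier]
      mult_mat_vec_unit[OF H k] by simp
  finally have "p = (H *\<^sub>v f + (p - f $ k) \<cdot>\<^sub>v col H k) $ k"
    unfolding p_def by (rule arg_cong)
  then have "p = (H *\<^sub>v f) $ k + (p - f $ k) * H $$ (k, k)"
    using H k by simp
  then show ?thesis
    unfolding p_def[symmetric] using f H k by (simp add: algebra_simps)
qed

theorem theorem2p5:
  fixes X Nodes :: "(real ^ 'd) set"
    and xs :: "(real ^ 'd) list"
    and I :: "'i set"
    and ns :: "'i list"
    and \<phi> :: "'i \<Rightarrow> real ^ 'd \<Rightarrow> complex"
    and w :: "real ^ 'd \<Rightarrow> real"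
    and wh :: "'i \<Rightarrow> real"
    and l :: real
    and f :: "complex vec"
    and F W Wh H :: "complex mat"
  assumes "finite I" and "finite Nodes" and "Nodes \<subseteq> X"
    and "distinct xs" and "set xs = Nodes"
    and "distinct ns" and "set ns = I"
    and "\<And>x. x \<in> Nodes \<Longrightarrow> w x > 0"
    and "\<And>n. n \<in> I \<Longrightarrow> wh n > 0"
    and "l > 0"
    and "f \<in> carrier_vec (card Nodes)"
    and "F = system_mat \<phi> xs ns"
    and "W = weight_mat w xs"
    and "Wh = weight_mat wh ns"
    and "H = hat_mat F W Wh l"
  shows "invertible_mat (tikhonov_mat F W Wh l) \<and>
         (\<forall>k<card Nodes.
            invertible_mat (tikhonov_mat (remove_row k F) (mat_delete W k k) Wh l) \<and>
            H $$ (k, k) \<noteq> 1) \<and>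
         complex_of_real (ocv_score F W Wh f l) =
           (\<Sum>k<card Nodes.
              complex_of_real ((cmod ((H *\<^sub>v f - f) $ k))\<^sup>2) / (1 - H $$ (k, k))\<^sup>2)"
proof -
  define n where "n = length xs"
  define m where "m = length ns"
  define a where "a = (\<lambda>k. w (xs ! k))"
  define b where "b = (\<lambda>j. wh (ns ! j))"
  have card: "card Nodes = n"
    using \<open>distinct xs\<close> \<open>set xs = Nodes\<close> distinct_card[of xs] unfolding n_def by simp
  have F: "F \<in> carrier_mat n m"
    unfolding \<open>F = system_mat \<phi> xs ns\<close> system_mat_def n_def m_def by simp
  have W: "W = rdiag n a" unfolding \<open>W = weight_mat w xs\<close> weight_mat_def n_def a_def ..
  have Wh: "Wh = rdiag m b" unfolding \<open>Wh = weight_mat wh ns\<close> weight_mat_def m_def b_def ..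
  have a: "\<forall>r<n. a r > 0"
    using assms(5,8) unfolding a_def n_def by auto
  have b: "\<forall>j<m. b j > 0"
    using assms(7,9) unfolding b_def m_def by auto
  note l = \<open>l > 0\<close>
  have f: "f \<in> carrier_vec n" using assms(11) card by simp
  have H: "H = hat_mat F (rdiag n a) (rdiag m b) l"
    using \<open>H = hat_mat F W Wh l\<close> W Wh by simp
  have inv: "invertible_mat (tikhonov_mat F W Wh l)"
    unfolding W Wh by (rule tikhonov_inverse(4)[OF F a b l])
  have loo_inv: "invertible_mat (tikhonov_mat (remove_row k F) (mat_delete W k k) Wh l)"
    if k: "k < n" for k
  proof -
    have G: "remove_row k F \<in> carrier_mat (n - 1) m" using remove_row_eq[OF F k] by simp
    have "\<forall>i<n - 1. a (insert_index k i) > 0"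
      using a by (auto simp: insert_index_def)
    then show ?thesis
      unfolding W Wh mat_delete_rdiag[OF k] by (rule tikhonov_inverse(4)[OF G _ b l])
  qed
  have h1: "H $$ (k, k) \<noteq> 1" if "k < n" for k
    unfolding H by (rule hat_mat_diag_neq_1[OF F that a b l])
  have summand: "complex_of_real ((cmod ((F *\<^sub>v loo_minimizer F W Wh l f k) $ k - f $ k))\<^sup>2) =
      complex_of_real ((cmod ((H *\<^sub>v f - f) $ k))\<^sup>2) / (1 - H $$ (k, k))\<^sup>2"
    if k: "k < n" for k
  proof -
    \<comment> \<open>The formula divides by a complex square, the score contains a squared modulus. They agree
      because the diagonal entry is real.\<close>
    obtain h where h: "H $$ (k, k) = complex_of_real h"
      using hat_mat_diag_real[OF F k a b l] unfolding H by (rule Reals_cases)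
    let ?p = "(F *\<^sub>v loo_minimizer F W Wh l f k) $ k - f $ k"
    have "1 - H $$ (k, k) = complex_of_real (1 - h)" using h by simp
    moreover from this have "1 - h \<noteq> 0" using h1[OF k] h by auto
    moreover have "?p * (1 - H $$ (k, k)) = (H *\<^sub>v f - f) $ k"
      unfolding W Wh H by (rule loo_residual[OF F f k a b l])
    ultimately have "(cmod ((H *\<^sub>v f - f) $ k))\<^sup>2 = (cmod ?p)\<^sup>2 * (1 - h)\<^sup>2"
      by (metis norm_mult norm_of_real power2_abs power_mult_distrib)
    then show ?thesis
      using \<open>1 - H $$ (k, k) = complex_of_real (1 - h)\<close> \<open>1 - h \<noteq> 0\<close>
      by (simp del: of_real_diff flip: of_real_power of_real_divide)
  qed
  have "complex_of_real (ocv_score F W Wh f l) =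
      (\<Sum>k<card Nodes. complex_of_real ((cmod ((H *\<^sub>v f - f) $ k))\<^sup>2) / (1 - H $$ (k, k))\<^sup>2)"
    unfolding ocv_score_def of_real_sum card carrier_matD(1)[OF F]
    by (rule sum.cong[OF refl], rule summand, simp)
  then show ?thesis using inv loo_inv h1 card by blast
qed

end
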